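(* For a complex parameter $\mu$, let $S_n(z;\mu)$, $n\ge -1$, be defined by $S_{-1}=S_0=1$ and $$S_{n+1}S_{n-1}=-z\left[S_n\frac{\partial^2S_n}{\partial z^2}-\left(\frac{\partial S_n}{\partial z}\right)^2\right]-S_n\frac{\partial S_n}{\partial z}+(z+\mu)S_n^2,\qquad n\ge0.$$ Let $\phi_n=\phi_n(\mu)=S_n(0;\mu)$ and $\phi_n'=\frac{\partial S_n}{\partial z}(0;\mu)$. Then for all $n\ge 3$, $$\phi_{n+1}=\frac{\phi_n\phi_{n-1}}{\phi_{n-2}}\left(2\mu^2-2n^2+2n-1-\frac{\phi_n\phi_{n-3}}{\phi_{n-1}\phi_{n-2}}\right),$$ $$\phi_{n+1}'=-\frac{\phi_n\phi_{n+2}}{\phi_{n+1}}+\mu\,\phi_{n+1}.$$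
   Context: The $S_n(z;\mu)$ are the Umemura polynomials associated with the third Painlevé equation, regarded as functions of $z$ and the parameter $\mu$; the identities are identities of functions of $\mu$. Here $\phi_n'$ denotes the $z$-derivative evaluated at $z=0$, not a derivative with respect to $\mu$. *)

theory Defs
  imports "HOL-Computational_Algebra.Polynomial" "HOL-Computational_Algebra.Fraction_Field"
begin

type_synonym ratfun = "complex poly fract"

definition mu :: ratfun where
  "mu = Fract [:0, 1:] 1"

definition umemura_rhs :: "ratfun poly \<Rightarrow> ratfun poly" where
  "umemura_rhs S =
     - [:0, 1:] * (S * pderiv (pderiv S) - (pderiv S)^2)
     - S * pderiv S + ([:0, 1:] + [:mu:]) * S^2"

fun S :: "nat \<Rightarrow> ratfun poly" where
  "S 0 = 1"
| "S (Suc 0) = umemura_rhs 1"   (* S_1 * S_{-1} = rhs(S_0), S_{-1} = 1 *)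
| "S (Suc (Suc n)) = umemura_rhs (S (Suc n)) div S n"

definition phi :: "nat \<Rightarrow> ratfun" where
  "phi n = poly (S n) 0"

definition phi' :: "nat \<Rightarrow> ratfun" where
  "phi' n = poly (pderiv (S n)) 0"

end

theory Submission
  imports Defs "HOL-Computational_Algebra.Formal_Laurent_Series"
    "HOL-Computational_Algebra.Polynomial_FPS"
begin

text \<open>
  Write $T(f)$ for the right-hand side of the recurrence, so that $S_{n+1} S_{n-1} = T(S_n)$.
  Dividing by $S_{n-1}$ leaves no remainder: $f$ always divides $T(T(f)) + (z+\mu) T(f)^2$,
  whence $S_n$ divides $S_{n-1}^2\, T(S_{n+1})$, and $S_n$, $S_{n-1}$ are comaximal.
  Comaximality rests on the bilinear relation
  $S_{n+1}' S_{n-1} - S_{n+1} S_{n-1}' = (2n+1) S_n^2$ (which makes $S_{n+1}$ squarefree) together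
  with $S_n(0) \neq 0$. At $z = 0$ the recurrence and the bilinear relation combine to
  $\phi_{n+1}\phi_{n-2} = (\mu^2 - n^2)\, \phi_n \phi_{n-1}$, which gives both the non-vanishing
  and, applied for $n$ and $n-1$, the stated recursion.
\<close>

section \<open>The Toda operator in a differential ring\<close>

locale toda_ring =
  fixes D :: "'a::comm_ring_1 \<Rightarrow> 'a" and z m :: 'a
  assumes D_add: "D (x + y) = D x + D y"
    and D_mult: "D (x * y) = D x * y + x * D y"
    and D_z: "D z = 1"
    and D_m: "D m = 0"
begin

lemma D_0: "D 0 = 0"
  using D_add[of 0 0] by simp

lemma D_1: "D 1 = 0"
  using D_mult[of 1 1] by simp

lemma D_minus: "D (- x) = - D x"
  using D_add[of x "- x"] D_0 by (simp add: eq_neg_iff_add_eq_0 add.commute)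

lemma D_diff: "D (x - y) = D x - D y"
  using D_add[of x "- y"] D_minus by simp

lemma D_power2: "D (x\<^sup>2) = 2 * x * D x"
  by (simp add: power2_eq_square D_mult algebra_simps)

lemmas D_simps = D_0 D_1 D_add D_mult D_minus D_diff D_power2 D_z D_m

definition toda :: "'a \<Rightarrow> 'a" where
  "toda f = - z * (f * D (D f) - (D f)\<^sup>2) - f * D f + (z + m) * f\<^sup>2"

text \<open>Formally toda f / f^2 is z + m minus the derivative of z times the logarithmic
  derivative of f. The latter is additive on products, so only the double-counted z + m is
  corrected.\<close>

lemma toda_mult: "toda (f * g) = f\<^sup>2 * toda g + g\<^sup>2 * toda f - (z + m) * (f * g)\<^sup>2"
  by (simp add: toda_def D_simps algebra_simps power2_eq_square)

text \<open>Modulo \<open>f\<close>, the element \<open>F\<close> and its first two derivatives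
  reduce to z p^2, z p q and \<open>E\<close>; the third derivative \<open>r\<close> cancels in
  \<open>E\<close>. Substituting leaves - z^2 p^2 (f p), which vanishes modulo
  \<open>f\<close>.\<close>

lemma dvd_toda_toda: "f dvd toda (toda f) + (z + m) * (toda f)\<^sup>2"
proof -
  define p q r where "p = D f" and "q = D p" and "r = D q"
  define A where "A = - z * q - p + (z + m) * f"
  define B where "B = - 2 * q - z * r + f + 2 * (z + m) * p"
  define E where "E = - p * q + z * q\<^sup>2 + 2 * (z + m) * p\<^sup>2 + f * p"
  define F where "F = toda f"
  have F: "F = z * p\<^sup>2 + f * A"
    by (simp add: F_def toda_def A_def p_def q_def algebra_simps power2_eq_square)
  have F1: "D F = z * p * q + f * B"
    unfolding F A_def B_def
    by (simp add: D_simps flip: p_def q_def r_def)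
       (simp add: algebra_simps power2_eq_square flip: p_def q_def r_def)
  have F2: "D (D F) = E + f * D B"
    unfolding F1
    by (simp add: D_simps E_def flip: p_def q_def r_def)
       (simp add: B_def algebra_simps power2_eq_square flip: p_def q_def r_def)
  have "toda F + (z + m) * F\<^sup>2 =
    f * (- z * (z * p^3 + z * p\<^sup>2 * D B + A * E + f * A * D B - 2 * z * p * q * B - f * B\<^sup>2)
         - (z * p\<^sup>2 * B + A * z * p * q + f * A * B) + 2 * (z + m) * (2 * z * p\<^sup>2 * A + f * A\<^sup>2))"
    unfolding toda_def F2 unfolding F1 unfolding F E_def
    by (simp add: algebra_simps power2_eq_square power3_eq_cube)
  then show ?thesis
    unfolding F_def by (rule dvdI)
qed

text \<open>Here \<open>a\<close>, \<open>b\<close>, \<open>c\<close> are consecutive terms.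
  Expanding toda (c a) by the product rule isolates a^2 toda c; the rest is divisible by
  \<open>b\<close>.\<close>

lemma dvd_toda_next:
  assumes "c * a = toda b" and "b dvd toda a"
  shows "b dvd a\<^sup>2 * toda c"
proof -
  have "a\<^sup>2 * toda c = toda (c * a) + (z + m) * (c * a)\<^sup>2 - c\<^sup>2 * toda a"
    by (simp add: toda_mult)
  then show ?thesis
    using assms dvd_toda_toda[of b] by (simp add: dvd_diff)
qed

end

section \<open>Logarithmic derivatives and the bilinear relation in a differential field\<close>

locale toda_field = toda_ring D z m for D :: "'a::field \<Rightarrow> 'a" and z m
begin

definition logd :: "'a \<Rightarrow> 'a" where
  "logd f = D f / f"

text \<open>The quotient toda f / f^2, written so that it is affine in the logarithmic
  derivative.\<close>

definition ratio :: "'a \<Rightarrow> 'a" where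
  "ratio f = z + m - D (z * logd f)"

lemma D_eq_logd: "f \<noteq> 0 \<Longrightarrow> D f = logd f * f"
  by (simp add: logd_def)

lemma toda_eq_ratio:
  assumes "f \<noteq> 0"
  shows "toda f = f\<^sup>2 * ratio f"
proof -
  have 1: "D f = logd f * f"
    using assms by (rule D_eq_logd)
  have "D (D f) = D (logd f) * f + logd f * (logd f * f)"
    using arg_cong[OF 1, of D] by (simp add: D_mult 1)
  then show ?thesis
    unfolding toda_def ratio_def
    by (simp add: 1 D_simps algebra_simps power2_eq_square)
qed

text \<open>
  Given the bilinear relation with constant $k$ on a triple $(a, b, c)$, this first-order relation
  on $(b, c)$ is equivalent to the bilinear relation with constant $k + 2$ on the next triple. The
  relation itself is passed on from $(a, b)$ to $(b, c)$, so that it drives the induction.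
\<close>

definition compat :: "'a \<Rightarrow> 'a \<Rightarrow> bool" where
  "compat a b \<longleftrightarrow>
     D (ratio a) + D (ratio b) = 2 + 2 * (logd b - logd a) * D (z * (logd b - logd a))"

text \<open>With R = c a / b^2, the relation \<open>W\<close> says (h + g) R = k, and
  differentiating c a = b^2 R gives (h - g) R = D R. Since k is constant, R can be eliminated,
  leaving a relation between g and h alone that carries \<open>compat\<close> forward.\<close>

lemma compat_step:
  assumes nz: "a \<noteq> 0" "b \<noteq> 0" "c \<noteq> 0"
    and tb: "c * a = toda b"
    and tc: "d * b = toda c"
    and W: "D c * a - c * D a = k * b\<^sup>2"
    and k: "D k = 0"
    and X: "compat a b"
  shows "compat b c" and "D d * b - d * D b = (k + 2) * c\<^sup>2"
proof -
  define R where "R = ratio b"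
  define g where "g = logd b - logd a"
  define h where "h = logd c - logd b"
  have ca: "c * a = b\<^sup>2 * R"
    using tb nz by (simp add: toda_eq_ratio R_def)
  then have R0: "R \<noteq> 0"
    using nz by auto
  have Rb: "R = ratio a - D (z * g)"
    by (simp add: R_def g_def ratio_def D_simps algebra_simps)
  have Rc: "ratio c = R - D (z * h)"
    by (simp add: R_def h_def ratio_def D_simps algebra_simps)
  have "b\<^sup>2 * ((h + g) * R) = (logd c - logd a) * (c * a)"
    unfolding ca by (simp add: h_def g_def algebra_simps)
  also have "\<dots> = b\<^sup>2 * k"
    using W nz by (simp add: D_eq_logd algebra_simps)
  finally have s: "(h + g) * R = k"
    using nz by simp
  have "D c * a + c * D a = D (b\<^sup>2 * R)"
    by (simp add: D_mult flip: ca)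
  then have "(logd c + logd a) * (c * a) = 2 * b * (logd b * b) * R + b\<^sup>2 * D R"
    using nz by (simp add: D_eq_logd D_simps algebra_simps)
  then have "b\<^sup>2 * ((h - g) * R) = b\<^sup>2 * D R"
    unfolding ca by (simp add: h_def g_def algebra_simps power2_eq_square)
  then have d: "(h - g) * R = D R"
    using nz by simp
  have "D (h + g) * R + (h + g) * ((h - g) * R) = 0"
    using arg_cong[OF s, of D] k by (simp add: D_mult d)
  then have "R * (D (h + g) + (h\<^sup>2 - g\<^sup>2)) = 0"
    by (simp add: algebra_simps power2_eq_square)
  then have s': "D (h + g) = g\<^sup>2 - h\<^sup>2"
    using R0 by (simp add: add_eq_0_iff2)
  \<comment> \<open>Differentiating z (h + g) twice yields exactly the difference between the
    right-hand sides of the two \<open>compat\<close> relations.\<close>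
  have "D (D (z * (h + g))) = 2 * (g\<^sup>2 - h\<^sup>2) + z * (2 * g * D g - 2 * h * D h)"
    by (simp add: D_mult D_z D_add[of "h + g"] D_1 s' D_diff D_power2)
  then have zs: "D (D (z * h)) + D (D (z * g)) = 2 * g * D (z * g) - 2 * h * D (z * h)"
    by (simp add: D_simps algebra_simps power2_eq_square)
  have "D (ratio a) + D R = 2 + 2 * g * D (z * g)"
    using X by (simp add: compat_def R_def g_def)
  moreover have "D R = D (ratio a) - D (D (z * g))"
    by (simp add: Rb D_diff)
  moreover have "D (ratio c) = D R - D (D (z * h))"
    by (simp add: Rc D_diff)
  ultimately have Y: "D R + D (ratio c) = 2 + 2 * h * D (z * h)"
    using zs by algebra
  then show "compat b c"
    by (simp add: compat_def R_def h_def)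
  \<comment> \<open>This is the new bilinear relation divided by c^2, because d b = c^2
    \<open>ratio c\<close>.\<close>
  have E: "D (ratio c) = k + 2 - 2 * h * ratio c"
    using Y Rc s d by algebra
  have db: "d * b = c\<^sup>2 * ratio c"
    using tc nz by (simp add: toda_eq_ratio)
  have "D d * b + d * D b = 2 * c * (logd c * c) * ratio c + c\<^sup>2 * D (ratio c)"
    using arg_cong[OF db, of D] nz by (simp add: D_mult D_power2 D_eq_logd)
  moreover have "d * D b = logd b * (c\<^sup>2 * ratio c)"
    using nz by (simp add: D_eq_logd flip: db)
  ultimately show "D d * b - d * D b = (k + 2) * c\<^sup>2"
    using E h_def by algebra
qed

end

section \<open>Comaximal elements\<close>

definition comax :: "'a::comm_ring_1 \<Rightarrow> 'a \<Rightarrow> bool" where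
  "comax p q \<longleftrightarrow> (\<exists>a b. a * p + b * q = 1)"

lemma comax_sym: "comax p q \<Longrightarrow> comax q p"
  unfolding comax_def by (metis add.commute)

lemma comax_mult:
  assumes "comax p q" "comax p r"
  shows "comax p (q * r)"
proof -
  obtain a b c d where "a * p + b * q = 1" "c * p + d * r = 1"
    using assms unfolding comax_def by blast
  moreover have "(a + b * q * c) * p + (b * d) * (q * r) = a * p + b * q * (c * p + d * r)"
    by (simp add: algebra_simps)
  ultimately have "(a + b * q * c) * p + (b * d) * (q * r) = 1"
    by simp
  then show ?thesis
    unfolding comax_def by blast
qed

lemma comax_multD: "comax p (q * r) \<Longrightarrow> comax p q"
  unfolding comax_def by (metis mult.assoc mult.commute)

lemma comax_dvd_cancel:
  assumes "comax p q" "p dvd q * r"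
  shows "p dvd r"
proof -
  obtain a b where ab: "a * p + b * q = 1"
    using assms unfolding comax_def by blast
  have "r = (a * p + b * q) * r"
    by (simp add: ab)
  also have "\<dots> = p * (a * r) + b * (q * r)"
    by (simp add: algebra_simps)
  finally show ?thesis
    using assms(2) by (metis dvd_add dvd_mult dvd_triv_left)
qed

lemma comax_cong:
  assumes "comax p q" "p dvd r - q"
  shows "comax p r"
proof -
  obtain a b where ab: "a * p + b * q = 1"
    using assms unfolding comax_def by blast
  obtain c where "r - q = p * c"
    using assms by blast
  then have c: "r = q + p * c"
    by (simp add: algebra_simps)
  have "(a - b * c) * p + b * r = 1"
    using ab by (simp add: c algebra_simps)
  then show ?thesis
    unfolding comax_def by blast
qed

lemma comax_const:
  fixes c :: "'a::field"
  assumes "c \<noteq> 0"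
  shows "comax p [:c:]"
proof -
  have "0 * p + [:inverse c:] * [:c:] = 1"
    using assms by (simp add: one_pCons)
  then show ?thesis
    unfolding comax_def by blast
qed

text \<open>Modulo the variable, \<open>p\<close> is its constant term, a unit.\<close>

lemma comax_X:
  fixes p :: "'a::field poly"
  assumes "poly p 0 \<noteq> 0"
  shows "comax p [:0, 1:]"
proof -
  obtain c q where p: "p = pCons c q"
    by (cases p)
  have "comax [:0, 1:] p"
  proof (rule comax_cong)
    show "comax [:0, 1:] [:c:]"
      using assms by (intro comax_const) (simp add: p)
    show "[:0, 1:] dvd p - [:c:]"
      by (rule dvdI[of _ _ q]) (simp add: p)
  qed
  then show ?thesis
    by (rule comax_sym)
qed

section \<open>The Umemura polynomials\<close>

lemma of_nat_ratfun_eq_0_iff: "(of_nat n :: ratfun) = 0 \<longleftrightarrow> n = 0"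
  by (simp add: of_nat_fract Zero_fract_def eq_fract)

text \<open>\<open>mu\<close> is an indeterminate, so the two squares have degrees 2 and 0 in it.
  This is what keeps every value at z = 0 nonzero.\<close>

lemma mu_sq_neq_of_nat_sq: "mu\<^sup>2 - (of_nat n)\<^sup>2 \<noteq> 0"
proof
  assume "mu\<^sup>2 - (of_nat n)\<^sup>2 = 0"
  then have "Fract ([:0, 1:]\<^sup>2) 1 = Fract ((of_nat n)\<^sup>2 :: complex poly) 1"
    by (simp add: mu_def of_nat_fract power2_eq_square Zero_fract_def eq_fract)
  then have "[:0, 1:]\<^sup>2 = ((of_nat n)\<^sup>2 :: complex poly)"
    by (simp add: eq_fract)
  then have "degree ([:0, 1:]\<^sup>2 :: complex poly) = degree ((of_nat n)\<^sup>2 :: complex poly)"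
    by simp
  then show False
    by (simp add: power2_eq_square of_nat_poly)
qed

section \<open>Polynomials and Laurent series as differential rings\<close>

interpretation P: toda_ring pderiv "[:0, 1:]" "[:mu:]"
  by unfold_locales (simp_all add: pderiv_add pderiv_mult pderiv_pCons one_pCons)

lemma P_toda: "P.toda = umemura_rhs"
  by (simp add: fun_eq_iff P.toda_def umemura_rhs_def)

text \<open>Laurent series form a differential field containing the polynomials, so logarithmic
  derivatives make sense there; polynomial identities are pulled back along the injection
  \<open>emb\<close>.\<close>

interpretation L: toda_field fls_deriv fls_X "fls_const mu"
  by unfold_locales simp_all

definition emb :: "ratfun poly \<Rightarrow> ratfun fls" where
  "emb p = fps_to_fls (fps_of_poly p)"

lemma emb_simps:
  "emb 1 = 1" "emb (p + q) = emb p + emb q" "emb (p - q) = emb p - emb q"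
  "emb (- p) = - emb p" "emb (p * q) = emb p * emb q" "emb (p\<^sup>2) = (emb p)\<^sup>2"
  "emb (pderiv p) = fls_deriv (emb p)" "emb [:0, 1:] = fls_X" "emb [:c:] = fls_const c"
  by (simp_all add: emb_def fps_of_poly_simps fps_of_poly_pderiv fls_times_fps_to_fls
      fls_deriv_fps_to_fls power2_eq_square)

lemma emb_inject: "emb p = emb q \<longleftrightarrow> p = q"
  by (simp add: emb_def fps_of_poly_eq_iff)

lemma emb_eq_0_iff: "emb p = 0 \<longleftrightarrow> p = 0"
  using emb_inject[of p 0] by (simp add: emb_def)

lemma emb_toda: "emb (umemura_rhs p) = L.toda (emb p)"
  unfolding umemura_rhs_def L.toda_def by (simp only: emb_simps)

text \<open>The paper's sequence shifted to start at 0, so that \<open>U n\<close> is $S_{n-1}$.\<close>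

definition U :: "nat \<Rightarrow> ratfun poly" where
  "U n = (case n of 0 \<Rightarrow> 1 | Suc k \<Rightarrow> S k)"

lemma U_0: "U 0 = 1" and U_1: "U (Suc 0) = 1" and U_Suc: "U (Suc n) = S n"
  by (simp_all add: U_def)

lemma U_rec: "U (n + 2) = umemura_rhs (U (n + 1)) div U n"
  by (cases n) (simp_all add: U_def)

section \<open>Values at zero and the inductive invariant\<close>

lemma umemura_rhs_1: "umemura_rhs 1 = [:mu, 1:]"
  by (simp add: umemura_rhs_def)

lemma poly_umemura_rhs_0:
  "poly (umemura_rhs p) 0 = mu * (poly p 0)\<^sup>2 - poly p 0 * poly (pderiv p) 0"
  by (simp add: umemura_rhs_def)

text \<open>The value at z = 0 of \<open>umemura_rhs (U n)\<close> divided by the square of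
  \<open>U n\<close>.\<close>

definition rho :: "nat \<Rightarrow> ratfun" where
  "rho n = mu - poly (pderiv (U n)) 0 / poly (U n) 0"

text \<open>Exact division, the bilinear relation and comaximality feed each other, so they are
  carried through one induction. The \<open>rho\<close> product secures nonvanishing at 0 and later
  yields the recursion for \<open>phi\<close>.\<close>

definition umemura_inv :: "nat \<Rightarrow> bool" where
  "umemura_inv n \<longleftrightarrow>
     U (n + 2) * U n = umemura_rhs (U (n + 1)) \<and>
     U (n + 1) dvd umemura_rhs (U n) \<and>
     pderiv (U (n + 2)) * U n - U (n + 2) * pderiv (U n) = [:of_nat (2 * n + 1):] * (U (n + 1))\<^sup>2 \<and>
     L.compat (emb (U n)) (emb (U (n + 1))) \<and>
     comax (U n) (U (n + 1)) \<and> comax (U (n + 1)) (pderiv (U (n + 1))) \<and>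
     poly (U n) 0 \<noteq> 0 \<and> poly (U (n + 1)) 0 \<noteq> 0 \<and>
     rho n * rho (n + 1) = mu\<^sup>2 - (of_nat n)\<^sup>2"

lemma umemura_inv_0: "umemura_inv 0"
proof -
  have 2: "U 2 = [:mu, 1:]"
    using U_rec[of 0] by (simp add: U_0 U_1 umemura_rhs_1 numeral_2_eq_2)
  \<comment> \<open>Both logarithmic derivatives vanish and the ratio is z + mu, so the relation
    reads 1 + 1 = 2.\<close>
  have "L.compat (emb 1) (emb 1)"
    by (simp add: L.compat_def L.logd_def L.ratio_def emb_simps)
  moreover have "comax (1 :: ratfun poly) 1"
    unfolding comax_def by (intro exI[of _ 1] exI[of _ 0]) simp
  moreover have "comax (1 :: ratfun poly) 0"
    unfolding comax_def by (intro exI[of _ 1] exI[of _ 0]) simp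
  ultimately show ?thesis
    by (simp add: umemura_inv_def U_0 U_1 2 umemura_rhs_1 rho_def pderiv_pCons power2_eq_square
        flip: numeral_2_eq_2)
qed

lemma umemura_inv_step:
  assumes "umemura_inv n"
  shows "umemura_inv (Suc n)"
proof -
  define a b c d where "a = U n" and "b = U (n + 1)" and "c = U (n + 2)" and "d = U (n + 3)"
  note defs = a_def b_def c_def d_def
  define k :: ratfun where "k = of_nat (2 * n + 1)"
  have k: "k \<noteq> 0"
    unfolding k_def of_nat_ratfun_eq_0_iff by simp
  have tb: "c * a = umemura_rhs b" and dv: "b dvd umemura_rhs a"
    and W: "pderiv c * a - c * pderiv a = [:k:] * b\<^sup>2"
    and X: "L.compat (emb a) (emb b)" and co: "comax a b" and bb': "comax b (pderiv b)"
    and a0: "poly a 0 \<noteq> 0" and b0: "poly b 0 \<noteq> 0"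
    and rho: "rho n * rho (n + 1) = mu\<^sup>2 - (of_nat n)\<^sup>2"
    using assms by (auto simp: umemura_inv_def defs k_def)
  have d_eq: "d = umemura_rhs c div b"
    using U_rec[of "n + 1"] by (simp add: defs numeral_3_eq_3 numeral_2_eq_2)
  have rho_b: "rho (n + 1) * (poly b 0)\<^sup>2 = mu * (poly b 0)\<^sup>2 - poly b 0 * poly (pderiv b) 0"
    using b0 unfolding rho_def b_def by (simp add: divide_simps algebra_simps power2_eq_square)
  have ca0: "poly c 0 * poly a 0 = rho (n + 1) * (poly b 0)\<^sup>2"
    using arg_cong[OF tb, of "\<lambda>p. poly p 0"] rho_b by (simp add: poly_umemura_rhs_0)
  have rho1: "rho (n + 1) \<noteq> 0"
    using rho mu_sq_neq_of_nat_sq[of n] by auto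
  then have c0: "poly c 0 \<noteq> 0"
    using ca0 b0 by auto
  have nz: "a \<noteq> 0" "b \<noteq> 0" "c \<noteq> 0"
    using a0 b0 c0 by auto
  have "b dvd a\<^sup>2 * umemura_rhs c"
    using P.dvd_toda_next[of c a b] tb dv by (simp add: P_toda)
  \<comment> \<open>Comaximality of \<open>a\<close> and \<open>b\<close> removes the factor a^2, so
    the division defining \<open>d\<close> is exact.\<close>
  then have "b dvd umemura_rhs c"
    using co comax_dvd_cancel comax_sym comax_mult power2_eq_square by metis
  then have tc: "d * b = umemura_rhs c"
    by (simp add: d_eq)
  have nz': "emb a \<noteq> 0" "emb b \<noteq> 0" "emb c \<noteq> 0"
    using nz by (simp_all add: emb_eq_0_iff)
  have tb': "emb c * emb a = L.toda (emb b)" and tc': "emb d * emb b = L.toda (emb c)"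
    using arg_cong[OF tb, of emb] arg_cong[OF tc, of emb] by (simp_all add: emb_simps emb_toda)
  have W': "fls_deriv (emb c) * emb a - emb c * fls_deriv (emb a) = fls_const k * (emb b)\<^sup>2"
    using arg_cong[OF W, of emb] unfolding emb_simps .
  have "fls_deriv (fls_const k) = 0"
    by simp
  note step = L.compat_step[OF nz' tb' tc' W' this X]
  \<comment> \<open>The constant grows by 2 at each step; it is split into ones so that
    \<open>emb_simps\<close> applies.\<close>
  have "[:of_nat (2 * Suc n + 1):] = [:k:] + 1 + (1 :: ratfun poly)"
    by (simp add: k_def one_pCons)
  then have k2: "emb [:of_nat (2 * Suc n + 1):] = fls_const k + 2"
    by (simp only: emb_simps) simp
  have "emb (pderiv d * b - d * pderiv b) = emb ([:of_nat (2 * Suc n + 1):] * c\<^sup>2)"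
    unfolding emb_simps(5)[of "[:_:]"] k2 using step(2) by (simp add: emb_simps)
  then have W2: "pderiv d * b - d * pderiv b = [:of_nat (2 * Suc n + 1):] * c\<^sup>2"
    by (simp only: emb_inject)
  \<comment> \<open>Modulo \<open>b\<close> only z (b')^2 survives in \<open>umemura_rhs b\<close>.
    As b(0) is nonzero and \<open>b\<close> is comaximal with b', \<open>b\<close> is comaximal with
    c a, hence with \<open>c\<close>.\<close>
  have "comax b ([:0, 1:] * (pderiv b)\<^sup>2)"
    using bb' comax_X[OF b0] by (simp add: comax_mult power2_eq_square del: mult_pCons_left)
  moreover have "umemura_rhs b - [:0, 1:] * (pderiv b)\<^sup>2 =
      b * (- [:0, 1:] * pderiv (pderiv b) - pderiv b + ([:0, 1:] + [:mu:]) * b)"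
    unfolding umemura_rhs_def by algebra
  ultimately have "comax b (umemura_rhs b)"
    by (metis comax_cong dvd_triv_left)
  then have bc: "comax b c"
    using comax_multD tb by metis
  \<comment> \<open>Modulo \<open>c\<close> the bilinear relation identifies c' a with k b^2, which
    is comaximal with \<open>c\<close> because k is a nonzero constant.\<close>
  then have "comax c ([:k:] * b\<^sup>2)"
    unfolding power2_eq_square using comax_sym comax_mult comax_const[OF k] by metis
  moreover have "pderiv c * a - [:k:] * b\<^sup>2 = c * pderiv a"
    using W by algebra
  ultimately have "comax c (pderiv c * a)"
    by (metis comax_cong dvd_triv_left)
  then have cc': "comax c (pderiv c)"
    by (rule comax_multD)
  \<comment> \<open>At z = 0 the bilinear relation divided by c a becomes a difference of
    \<open>rho\<close> values. Then mu^2 - n^2 - (2n + 1) = mu^2 - (n + 1)^2.\<close>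
  have "rho n - rho (n + 2) = poly (pderiv c) 0 / poly c 0 - poly (pderiv a) 0 / poly a 0"
    by (simp add: rho_def a_def c_def)
  then have "(rho n - rho (n + 2)) * (poly c 0 * poly a 0) = k * (poly b 0)\<^sup>2"
    using arg_cong[OF W, of "\<lambda>p. poly p 0"] a0 c0
    by (simp add: field_simps)
  then have "(rho n - rho (n + 2)) * rho (n + 1) = k"
    using b0 by (simp add: ca0)
  moreover have "k = 2 * of_nat n + 1"
    by (simp add: k_def)
  ultimately have "rho (n + 1) * rho (n + 2) = mu\<^sup>2 - (of_nat n + 1)\<^sup>2"
    using rho by algebra
  moreover have "c dvd umemura_rhs b"
    by (simp flip: tb)
  ultimately show ?thesis
    using tc W2 step(1) bc cc' c0 b0
    by (simp add: umemura_inv_def defs numeral_3_eq_3 numeral_2_eq_2 add.commute)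
qed

lemma umemura_inv: "umemura_inv n"
  by (induction n) (simp_all add: umemura_inv_0 umemura_inv_step)

section \<open>Recursions for the values at zero\<close>

lemma phi_eq: "phi n = poly (U (n + 1)) 0" and phi'_eq: "phi' n = poly (pderiv (U (n + 1))) 0"
  by (simp_all add: phi_def phi'_def U_Suc)

lemma phi_neq_0: "phi n \<noteq> 0"
  using umemura_inv[of n] by (simp add: umemura_inv_def phi_eq)

text \<open>At z = 0 the factor z kills the second-order part of the recurrence. Solving for
  \<open>phi'\<close> gives the second claim of the theorem.\<close>

lemma phi_toda: "phi (n + 2) * phi n = mu * (phi (n + 1))\<^sup>2 - phi (n + 1) * phi' (n + 1)"
proof -
  have "U (n + 3) * U (n + 1) = umemura_rhs (U (n + 2))"
    using umemura_inv[of "n + 1"] by (simp add: umemura_inv_def eval_nat_numeral)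
  then have "poly (U (n + 3) * U (n + 1)) 0 = poly (umemura_rhs (U (n + 2))) 0"
    by simp
  then show ?thesis
    by (simp add: poly_umemura_rhs_0 phi_eq phi'_eq eval_nat_numeral)
qed

text \<open>Each \<open>r (k + 1)\<close> is phi(k+2) phi(k) / phi(k+1)^2, and the product of two
  consecutive such quotients telescopes.\<close>

lemma phi_four_term:
  "phi (n + 3) * phi n = (mu\<^sup>2 - (of_nat n + 2)\<^sup>2) * phi (n + 1) * phi (n + 2)"
proof -
  define r where "r k = mu - phi' k / phi k" for k
  have r: "phi (k + 2) * phi k = r (k + 1) * (phi (k + 1))\<^sup>2" for k
    using phi_toda[of k] phi_neq_0[of "k + 1"]
    by (simp add: r_def divide_simps) (simp add: algebra_simps power2_eq_square)
  \<comment> \<open>\<open>r k\<close> is \<open>rho (k + 1)\<close> because \<open>phi k\<close> is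
    read off \<open>U (k + 1)\<close>; hence the invariant is taken at n + 2.\<close>
  have "r (n + 1) * r (n + 2) = mu\<^sup>2 - (of_nat n + 2)\<^sup>2"
    using umemura_inv[of "n + 2"]
    by (simp add: umemura_inv_def r_def rho_def phi_eq phi'_eq add.commute)
  moreover have "(phi (n + 3) * phi n) * (phi (n + 1) * phi (n + 2)) =
      (r (n + 1) * r (n + 2) * phi (n + 1) * phi (n + 2)) * (phi (n + 1) * phi (n + 2))"
    using r[of n] r[of "n + 1"] by (simp add: eval_nat_numeral) algebra
  ultimately show ?thesis
    using phi_neq_0[of "n + 1"] phi_neq_0[of "n + 2"] by simp
qed

theorem theorem4p1:
  fixes n :: nat
  assumes "n \<ge> 3"
  shows "phi (n + 1) = phi n * phi (n - 1) / phi (n - 2) *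
           (2 * mu^2 - 2 * of_nat n ^ 2 + 2 * of_nat n - 1
            - phi n * phi (n - 3) / (phi (n - 1) * phi (n - 2)))
     \<and> phi' (n + 1) = - (phi n * phi (n + 2) / phi (n + 1)) + mu * phi (n + 1)"
proof
  obtain m where n: "n = m + 3"
    using assms by (metis add.commute le_Suc_ex)
  define x :: ratfun where "x = of_nat m"
  \<comment> \<open>The quotient inside the bracket equals mu^2 - (n - 1)^2, where n - 1 is x +
    2.\<close>
  have four: "phi (m + 3) * phi m / (phi (m + 2) * phi (m + 1)) = mu\<^sup>2 - (x + 2)\<^sup>2"
    using phi_four_term[of m] phi_neq_0[of "m + 1"] phi_neq_0[of "m + 2"]
    by (simp add: x_def field_simps)
  have "phi (m + 4) * phi (m + 1) = (mu\<^sup>2 - (x + 3)\<^sup>2) * phi (m + 2) * phi (m + 3)"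
    using phi_four_term[of "m + 1"] by (simp add: x_def eval_nat_numeral add_ac)
  then have "phi (m + 4) = phi (m + 3) * phi (m + 2) / phi (m + 1) * (mu\<^sup>2 - (x + 3)\<^sup>2)"
    using phi_neq_0[of "m + 1"] by (simp add: field_simps)
  \<comment> \<open>The four-term factor mu^2 - n^2 is rewritten so that mu^2 - (n - 1)^2 appears
    and can be replaced by that quotient.\<close>
  also have "mu\<^sup>2 - (x + 3)\<^sup>2 = 2 * mu\<^sup>2 - 2 * (x + 3)\<^sup>2 + 2 * (x + 3) - 1 - (mu\<^sup>2 - (x + 2)\<^sup>2)"
    by algebra
  finally show "phi (n + 1) = phi n * phi (n - 1) / phi (n - 2) *
           (2 * mu^2 - 2 * of_nat n ^ 2 + 2 * of_nat n - 1
            - phi n * phi (n - 3) / (phi (n - 1) * phi (n - 2)))"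
    unfolding four[symmetric] by (simp add: n x_def add.commute)
  show "phi' (n + 1) = - (phi n * phi (n + 2) / phi (n + 1)) + mu * phi (n + 1)"
    using phi_toda[of n] phi_neq_0[of "n + 1"] by (simp add: field_simps power2_eq_square)
qed

end
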